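(* Let $z\ge 1$ be a constant. For every dataset $X$ of $n$ points in $\mathbb{R}^d$, all $\varepsilon,\delta\in(0,0.5)$ and every integer $k\ge 1$, let $\varepsilon'=\frac{\varepsilon^{z+3}}{6\cdot(84z)^{2z}}$. There exists a subspace $\Gamma\subsetneq\mathbb{R}^d$ of dimension $O(k/\varepsilon')$ such that any weighted point set $S\subseteq X$ with weight function $w:S\to\mathbb{R}_{\ge 0}$ is an $O(\varepsilon)$-coreset for $(k,z)$-clustering over $X$ if the following three conditions hold: 1. $S$ is an $\varepsilon$-coreset for $(k,z)$-clustering over $X$ in the subspace $\Gamma'$, i.e. for every $k$-center set $C\subset\Gamma'$, $\sum_{x\in S}w(x)\,d^z(x,C)\in(1\pm\varepsilon)\,\mathrm{cost}_z(X,C)$; 2. $S$ is an $\varepsilon'$-weak-coreset for the $(k,z)$-subspace approximation problem over $X$ in $\Gamma^\perp$; 3. $S$ approximately preserves the $\ell_z$-subspace approximation objective with respect to $\Gamma$, i.e. $$\left|\sum_{x\in S}w(x)\,d^z(x,\Gamma)-\sum_{x\in X}d^z(x,\Gamma)\right|\le\varepsilon'\cdot\mathrm{OPT}_z.$$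
   Context: $d(x,y)$ is the Euclidean distance on $\mathbb{R}^d$; for a nonempty set $A$, $d(x,A)=\inf_{a\in A}d(x,a)$ and $d^z(x,A)=(d(x,A))^z$. $\mathcal{C}$ is the collection of all ordered $k$-tuples of points of $\mathbb{R}^d$ (repetitions allowed), called $k$-center sets; $\mathrm{cost}_z(X,C)=\sum_{x\in X}d^z(x,C)$ and $\mathrm{OPT}_z=\min_{C\in\mathcal{C}}\mathrm{cost}_z(X,C)$. The notation $a\in(1\pm\varepsilon)b$ means $(1-\varepsilon)b\le a\le(1+\varepsilon)b$. $(S,w)$ is an $\eta$-coreset for $(k,z)$-clustering over $X$ if $\sum_{x\in S}w(x)\,d^z(x,C)\in(1\pm\eta)\,\mathrm{cost}_z(X,C)$ for all $C\in\mathcal{C}$. Given a proper subspace $\Gamma\subsetneq\mathbb{R}^d$, $\Gamma'$ denotes a subspace obtained from $\Gamma$ by appending one arbitrary dimension of $\mathbb{R}^d$ orthogonal to $\Gamma$ (i.e. $\Gamma'=\mathrm{span}(\Gamma\cup\{v\})$ for some nonzero $v\perp\Gamma$), and $\Gamma^\perp$ is the orthogonal complement of $\Gamma$. Weak-coreset: for a point set $Y$ in a Euclidean space, let $\mathcal{P}$ be the collection of all its subspaces of dimension at most $k$; a weighted set $(T,w)$ is an $\eta$-weak-coreset for $(k,z)$-subspace approximation over $Y$ if $\min_{P\in\mathcal{P}}\sum_{y\in T}w(y)\,d^z(y,P)\in(1\pm\eta)\min_{P\in\mathcal{P}}\sum_{y\in Y}d^z(y,P)$. "In $\Gamma^\perp$"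 means that points of $X$ and $S$ are regarded as points of $\Gamma^\perp$ via orthogonal projection; equivalently, with $H$ ranging over subspaces of $\Gamma^\perp$ of dimension at most $k$, $\min_H\sum_{x\in S}w(x)\,d^z(x,\mathrm{span}(\Gamma\cup H))\in(1\pm\varepsilon')\min_H\sum_{x\in X}d^z(x,\mathrm{span}(\Gamma\cup H))$. Since $z$ is treated as a constant, constants implied by $O(\cdot)$ may depend on $z$ only. *)

theory Defs
  imports "HOL-Analysis.Analysis"
begin

text \<open>
  The \<open>O(\<cdot>)\<close>-constants of the statement must not depend on the dimension \<open>d\<close>, so \<open>d\<close> has to be
  quantified inside the formula and cannot be a type. Hence all spaces \<open>\<real>\<^sup>d\<close> are realised inside one
  inner product space, that of the finitely supported real sequences, as the sets of sequences
  vanishing from index \<open>d\<close> on. (The library type of finitely supported functions already carries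
  the \<open>\<ell>\<^sub>1\<close>-norm, hence a separate type.)
\<close>

typedef fseq = "{f :: nat \<Rightarrow> real. finite {i. f i \<noteq> 0}}"
  morphisms coord Abs_fseq
  by (rule exI[of _ "\<lambda>_. 0"]) simp

setup_lifting type_definition_fseq

lemma finite_coord [simp]: "finite {i. coord x i \<noteq> 0}"
  using coord[of x] by simp

lemma fseq_eqI: "(\<And>i. coord x i = coord y i) \<Longrightarrow> x = y"
  by (simp add: coord_inject[symmetric] fun_eq_iff)

instantiation fseq :: real_vector
begin

lift_definition zero_fseq :: fseq is "\<lambda>_. 0" by simp

lift_definition plus_fseq :: "fseq \<Rightarrow> fseq \<Rightarrow> fseq" is "\<lambda>f g i. f i + g i"
  by (rule finite_subset[rotated], erule (1) finite_UnI) auto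

lift_definition uminus_fseq :: "fseq \<Rightarrow> fseq" is "\<lambda>f i. - f i" by simp

lift_definition minus_fseq :: "fseq \<Rightarrow> fseq \<Rightarrow> fseq" is "\<lambda>f g i. f i - g i"
  by (rule finite_subset[rotated], erule (1) finite_UnI) auto

lift_definition scaleR_fseq :: "real \<Rightarrow> fseq \<Rightarrow> fseq" is "\<lambda>r f i. r * f i"
  by (erule finite_subset[rotated]) auto

instance
  by standard (transfer; simp add: algebra_simps)+

end

lemma coord_simps [simp]:
  "coord 0 i = 0" "coord (x + y) i = coord x i + coord y i" "coord (- x) i = - coord x i"
  "coord (x - y) i = coord x i - coord y i" "coord (r *\<^sub>R x) i = r * coord x i"
  by (transfer; simp)+

lemma coord_sum [simp]: "coord (sum f A) i = (\<Sum>a\<in>A. coord (f a) i)"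
  by (induction A rule: infinite_finite_induct) auto

instantiation fseq :: real_inner
begin

definition inner_fseq :: "fseq \<Rightarrow> fseq \<Rightarrow> real" where
  "inner_fseq x y = (\<Sum>i | coord x i \<noteq> 0. coord x i * coord y i)"

definition norm_fseq :: "fseq \<Rightarrow> real" where
  "norm_fseq x = sqrt (inner x x)"

definition dist_fseq :: "fseq \<Rightarrow> fseq \<Rightarrow> real" where
  "dist_fseq x y = norm (x - y)"

definition sgn_fseq :: "fseq \<Rightarrow> fseq" where
  "sgn_fseq x = x /\<^sub>R norm x"

definition uniformity_fseq :: "(fseq \<times> fseq) filter" where
  "uniformity_fseq = (INF e\<in>{0<..}. principal {(x, y). dist x y < e})"

definition open_fseq :: "fseq set \<Rightarrow> bool" where
  "open_fseq U = (\<forall>x\<in>U. \<forall>\<^sub>F (x', y) in uniformity. x' = x \<longrightarrow> y \<in> U)"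

lemma inner_fseq_superset:
  assumes "finite A" "{i. coord x i \<noteq> 0} \<subseteq> A"
  shows "inner x y = (\<Sum>i\<in>A. coord x i * coord y i)"
  unfolding inner_fseq_def using assms by (intro sum.mono_neutral_left) auto

instance
proof
  fix x y z :: fseq and r :: real
  let ?A = "{i. coord x i \<noteq> 0} \<union> {i. coord y i \<noteq> 0}"
  have fin: "finite ?A" by simp
  show "dist x y = norm (x - y)" by (simp add: dist_fseq_def)
  show "sgn x = x /\<^sub>R norm x" by (simp add: sgn_fseq_def)
  show "norm x = sqrt (inner x x)" by (simp add: norm_fseq_def)
  show "inner x y = inner y x"
    by (subst (1 2) inner_fseq_superset[OF fin]) (auto simp: mult.commute)
  show "inner (x + y) z = inner x z + inner y z"
    by (subst (1 2 3) inner_fseq_superset[OF fin]) (auto simp: algebra_simps sum.distrib)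
  show "inner (r *\<^sub>R x) y = r * inner x y"
    by (subst (1 2) inner_fseq_superset[OF fin]) (auto simp: sum_distrib_left mult.assoc)
  show "0 \<le> inner x x" by (simp add: inner_fseq_def sum_nonneg)
  show "inner x x = 0 \<longleftrightarrow> x = 0"
    by (auto simp: inner_fseq_def sum_nonneg_eq_0_iff intro: fseq_eqI)
qed (simp_all add: uniformity_fseq_def open_fseq_def)

end

definition Rd :: "nat \<Rightarrow> fseq set" where
  "Rd d = {x. \<forall>i\<ge>d. coord x i = 0}"

lemma subspace_Rd: "subspace (Rd d)"
  by (auto simp: subspace_def Rd_def)

lemma inner_Rd:
  assumes "x \<in> Rd d"
  shows "inner x y = (\<Sum>i<d. coord x i * coord y i)"
  using assms by (intro inner_fseq_superset) (auto simp: Rd_def not_le[symmetric])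

lemma dist_Rd:
  assumes "x \<in> Rd d" "y \<in> Rd d"
  shows "dist x y = sqrt (\<Sum>i<d. (coord x i - coord y i)\<^sup>2)"
proof -
  have "x - y \<in> Rd d" using assms by (auto simp: Rd_def)
  from inner_Rd[OF this, of "x - y"] show ?thesis
    by (simp add: dist_norm norm_eq_sqrt_inner power2_eq_square)
qed

lift_definition unit :: "nat \<Rightarrow> fseq" is "\<lambda>n i. if i = n then 1 else 0"
  by simp

lemma coord_unit [simp]: "coord (unit n) i = (if i = n then 1 else 0)"
  by transfer simp

lemma inj_unit: "inj unit"
  by (rule injI) (metis coord_unit zero_neq_one)

lemma dim_Rd: "dim (Rd d) = d"
proof -
  have "independent (unit ` {..<d})"
  proof (rule independent_if_scalars_zero)
    fix f x assume s: "(\<Sum>u\<in>unit ` {..<d}. f u *\<^sub>R u) = 0" and "x \<in> unit ` {..<d}"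
    then obtain n where n: "n < d" "x = unit n" by auto
    have "0 = coord (\<Sum>i<d. f (unit i) *\<^sub>R unit i) n"
      using s by (subst (asm) sum.reindex) (auto intro: inj_on_subset[OF inj_unit])
    also have "\<dots> = f (unit n)"
      using n by (simp add: if_distrib[of "\<lambda>a. _ * a"] sum.delta cong: if_cong)
    finally show "f x = 0" using n by simp
  qed simp
  moreover have "unit ` {..<d} \<subseteq> Rd d" by (auto simp: Rd_def)
  moreover have "Rd d \<subseteq> span (unit ` {..<d})"
  proof
    fix x assume x: "x \<in> Rd d"
    have "x = (\<Sum>i<d. coord x i *\<^sub>R unit i)"
      using x by (intro fseq_eqI)
        (auto simp: Rd_def if_distrib[of "\<lambda>a. _ * a"] not_less[symmetric] cong: if_cong)
    also have "\<dots> \<in> span (unit ` {..<d})"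
      by (intro span_sum span_scale span_base) auto
    finally show "x \<in> span (unit ` {..<d})" .
  qed
  ultimately have "dim (Rd d) = card (unit ` {..<d})"
    by (intro dim_unique) auto
  then show ?thesis by (simp add: card_image inj_on_subset[OF inj_unit])
qed

definition dist_pow :: "real \<Rightarrow> 'a::metric_space \<Rightarrow> 'a set \<Rightarrow> real" where
  "dist_pow z x A = infdist x A powr z"

text \<open>\<open>approx \<epsilon> b a\<close> is \<open>a \<in> (1 \<plusminus> \<epsilon>) b\<close>.\<close>

definition approx :: "real \<Rightarrow> real \<Rightarrow> real \<Rightarrow> bool" where
  "approx \<epsilon> b a \<longleftrightarrow> (1 - \<epsilon>) * b \<le> a \<and> a \<le> (1 + \<epsilon>) * b"

definition cost :: "real \<Rightarrow> 'a::metric_space set \<Rightarrow> 'a set \<Rightarrow> real" where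
  "cost z X A = (\<Sum>x\<in>X. dist_pow z x A)"

definition wcost :: "real \<Rightarrow> 'a::metric_space set \<Rightarrow> ('a \<Rightarrow> real) \<Rightarrow> 'a set \<Rightarrow> real" where
  "wcost z S w A = (\<Sum>x\<in>S. w x * dist_pow z x A)"

definition center_tuples :: "nat \<Rightarrow> 'a set \<Rightarrow> 'a list set" where
  "center_tuples k V = {C. length C = k \<and> set C \<subseteq> V}"

text \<open>
  In the two minima below the minimum is attained for the finite-dimensional \<open>V\<close> and \<open>E\<close> and
  nonnegative weights to which the definitions are applied; hence they are written as infima.
\<close>

definition opt_cost :: "nat \<Rightarrow> real \<Rightarrow> 'a::metric_space set \<Rightarrow> 'a set \<Rightarrow> real" where
  "opt_cost k z V X = (INF C\<in>center_tuples k V. cost z X (set C))"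

text \<open>
  Coreset with respect to center sets in \<open>V\<close>: the usual notion for \<open>V = \<real>\<^sup>d\<close>, and the
  coreset property ``in the subspace \<open>V\<close>'' for a subspace \<open>V\<close>.
\<close>

definition coreset ::
  "real \<Rightarrow> nat \<Rightarrow> real \<Rightarrow> 'a::metric_space set \<Rightarrow> 'a set \<Rightarrow> 'a set \<Rightarrow> ('a \<Rightarrow> real) \<Rightarrow> bool" where
  "coreset \<eta> k z V X S w \<longleftrightarrow>
     (\<forall>C\<in>center_tuples k V. approx \<eta> (cost z X (set C)) (wcost z S w (set C)))"

text \<open>
  Subspace approximation takes an indexed family \<open>f x\<close>, \<open>x \<in> Y\<close>, of points of the Euclidean
  space \<open>E\<close> rather than a set, because different points may have the same projection.
\<close>

definition opt_subspace ::
  "nat \<Rightarrow> real \<Rightarrow> 'a::real_inner set \<Rightarrow> ('b \<Rightarrow> 'a) \<Rightarrow> 'b set \<Rightarrow> ('b \<Rightarrow> real) \<Rightarrow> real" where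
  "opt_subspace k z E f Y w =
     (INF P\<in>{P. subspace P \<and> P \<subseteq> E \<and> dim P \<le> k}. \<Sum>x\<in>Y. w x * dist_pow z (f x) P)"

definition weak_coreset ::
  "real \<Rightarrow> nat \<Rightarrow> real \<Rightarrow> 'a::real_inner set \<Rightarrow> ('b \<Rightarrow> 'a) \<Rightarrow> 'b set \<Rightarrow> 'b set \<Rightarrow> ('b \<Rightarrow> real) \<Rightarrow> bool" where
  "weak_coreset \<eta> k z E f Y T w \<longleftrightarrow>
     approx \<eta> (opt_subspace k z E f Y (\<lambda>_. 1)) (opt_subspace k z E f T w)"

definition orth_proj :: "'a::real_inner set \<Rightarrow> 'a \<Rightarrow> 'a" where
  "orth_proj E x = (THE y. y \<in> E \<and> (\<forall>e\<in>E. orthogonal (x - y) e))"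

lemma orth_proj_eqI:
  assumes "subspace E" "y \<in> E" "\<And>e. e \<in> E \<Longrightarrow> orthogonal (x - y) e"
  shows "orth_proj E x = y"
  unfolding orth_proj_def
proof (rule the_equality)
  fix y' assume y': "y' \<in> E \<and> (\<forall>e\<in>E. orthogonal (x - y') e)"
  have "y' - y \<in> E" using assms y' by (simp add: subspace_diff)
  with assms y' have "inner ((x - y) - (x - y')) (y' - y) = 0"
    unfolding inner_diff_left[of "x - y"] by (simp add: orthogonal_def)
  then show "y' = y" by simp
qed (use assms in auto)

end

theory Submission
  imports Defs
begin

text \<open>
  Start from the span of a center set of cost at most twice the optimum (from the span of \<open>X\<close> itself
  if \<open>X\<close> has at most \<open>k\<close> points, since then the optimum vanishes) and keep adding \<open>k\<close>
  dimensions as long as this lowers the cost by more than \<open>\<epsilon>'\<close> times the optimum. This stops after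
  at most about \<open>2 / \<epsilon>'\<close> rounds, at \<open>\<Gamma>\<close> say. Write \<open>q\<close> for the component of a point \<open>x\<close> orthogonal to
  \<open>\<Gamma>\<close>. No \<open>k\<close>-dimensional \<open>H \<subseteq> \<Gamma>\<^sup>\<bottom>\<close> captures much of the \<open>q\<close>'s, neither over \<open>X\<close> nor, by the last two
  hypotheses, over \<open>S\<close>. Hence the distance of \<open>x\<close> to a center \<open>a + b\<close> with \<open>a \<in> \<Gamma>\<close>, \<open>b \<bottom> \<Gamma>\<close>
  hardly depends on the direction of \<open>b\<close>, and replacing \<open>b\<close> by \<open>\<bar>b\<bar> u\<close>, where \<open>u\<close> is the unit
  vector along \<open>v\<close>, moves all centers into \<open>\<Gamma>'\<close> at a relative cost of \<open>O(\<epsilon>)\<close>. There the first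
  hypothesis applies.
\<close>

subsection \<open>Inequalities for real powers\<close>

text \<open>Mean value theorem: the derivative \<open>z * c powr (z - 1)\<close> is nondecreasing in
  \<open>c\<close> because \<open>z \<ge> 1\<close>, so its value at \<open>x\<close> dominates. The
  case \<open>y = 0\<close> is split off since the derivative rule for \<open>powr\<close> asks for
  a positive base.\<close>

lemma powr_diff_le:
  fixes x y z :: real
  assumes "1 \<le> z" "0 \<le> y" "y \<le> x"
  shows "x powr z - y powr z \<le> z * (x - y) * x powr (z - 1)"
proof (cases "y = 0 \<or> y = x")
  case True
  have "x powr z = x * x powr (z - 1)"
    using assms by (simp add: powr_mult_base)
  moreover have "1 * x powr z \<le> z * x powr z"
    using assms by (intro mult_right_mono) auto
  ultimately have "x powr z \<le> z * x * x powr (z - 1)" by (simp add: mult.assoc)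
  with True show ?thesis by auto
next
  case False
  with assms have y: "0 < y" "y < x" by auto
  have "\<exists>c. y < c \<and> c < x \<and> x powr z - y powr z = (x - y) * (z * c powr (z - 1))"
    using y by (intro MVT2) (auto intro!: has_real_derivative_powr)
  then obtain c where c: "y < c" "c < x" "x powr z - y powr z = (x - y) * (z * c powr (z - 1))"
    by blast
  have "c powr (z - 1) \<le> x powr (z - 1)"
    using c y assms by (intro powr_mono2) auto
  then have "(x - y) * (z * c powr (z - 1)) \<le> (x - y) * (z * x powr (z - 1))"
    using assms by (intro mult_left_mono) auto
  with c(3) show ?thesis by (simp add: mult_ac)
qed

text \<open>Split one factor off each power; the remaining exponent \<open>p - 1\<close> is
  nonnegative, so enlarging both bases to \<open>a + b\<close> only increases the sum.\<close>

lemma powr_add_superadditive: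
  fixes a b p :: real
  assumes "1 \<le> p" "0 \<le> a" "0 \<le> b"
  shows "a powr p + b powr p \<le> (a + b) powr p"
proof -
  have "a * a powr (p - 1) + b * b powr (p - 1) \<le> a * (a + b) powr (p - 1) + b * (a + b) powr (p - 1)"
    using assms by (intro add_mono mult_left_mono powr_mono2) auto
  also have "\<dots> = (a + b) * (a + b) powr (p - 1)" by (simp add: distrib_right)
  finally show ?thesis using assms by (simp add: powr_mult_base)
qed

lemma powr_add_le_sum:
  fixes a b p :: real
  assumes "0 \<le> p" "0 \<le> a" "0 \<le> b"
  shows "(a + b) powr p \<le> 2 powr p * (a powr p + b powr p)"
proof -
  have "(a + b) powr p \<le> (2 * max a b) powr p"
    using assms by (intro powr_mono2) auto
  also have "\<dots> = 2 powr p * max a b powr p" using assms by (simp add: powr_mult)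
  also have "max a b powr p \<le> a powr p + b powr p" by (simp add: max_def)
  finally show ?thesis by simp
qed

text \<open>A triangle inequality for powers with tunable loss. The difference is at most
  \<open>z * t * (a + t) powr (z - 1)\<close>. If \<open>t \<le> e * a\<close>, then
  \<open>a + t \<le> 2 * a\<close> and the first term on the right suffices; otherwise
  \<open>a + t \<le> 2 * (t / e)\<close> and the second one does, which is the origin of
  \<open>e powr (1 - z)\<close>.\<close>

lemma powr_perturb:
  fixes a b e z :: real
  assumes "1 \<le> z" "0 \<le> a" "0 \<le> b" "0 < e" "e \<le> 1" "\<bar>a - b\<bar> \<le> t"
  shows "\<bar>a powr z - b powr z\<bar> \<le> z * 2 powr z * (e * a powr z + e powr (1 - z) * t powr z)"
proof -
  have t: "0 \<le> t" using assms by linarith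
  have "\<bar>a powr z - b powr z\<bar> \<le> z * t * (a + t) powr (z - 1)"
  proof -
    \<comment> \<open>Serves both orders of \<open>a\<close> and \<open>b\<close>: the larger of the
      two is at most \<open>a + t\<close> in either case.\<close>
    have *: "x powr z - y powr z \<le> z * t * (a + t) powr (z - 1)"
      if "0 \<le> y" "y \<le> x" "x \<le> a + t" "x - y \<le> t" for x y
    proof -
      have "x powr z - y powr z \<le> z * (x - y) * x powr (z - 1)"
        using that assms by (intro powr_diff_le) auto
      also have "\<dots> \<le> z * t * (a + t) powr (z - 1)"
        using that assms t by (intro mult_mono powr_mono2) auto
      finally show ?thesis .
    qed
    show ?thesis
    proof (cases "b \<le> a")
      case True
      then have "b powr z \<le> a powr z" using assms by (intro powr_mono2) auto
      with *[of b a] True assms t show ?thesis by auto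
    next
      case False
      then have "a powr z \<le> b powr z" using assms by (intro powr_mono2) auto
      with *[of a b] False assms t show ?thesis by auto
    qed
  qed
  also have "\<dots> \<le> z * 2 powr z * (e * a powr z + e powr (1 - z) * t powr z)"
  proof (cases "t \<le> e * a")
    case True
    have "e * a \<le> 1 * a" using assms by (intro mult_right_mono) auto
    with True have "a + t \<le> 2 * a" by simp
    then have "z * t * (a + t) powr (z - 1) \<le> z * (e * a) * (2 * a) powr (z - 1)"
      using True assms t by (intro mult_mono powr_mono2) auto
    also have "\<dots> = z * 2 powr (z - 1) * (e * a powr z)"
      using assms by (simp add: powr_mult powr_mult_base)
    also have "\<dots> \<le> z * 2 powr z * (e * a powr z)"
      using assms by (intro mult_right_mono mult_left_mono powr_mono) auto
    also have "\<dots> \<le> z * 2 powr z * (e * a powr z + e powr (1 - z) * t powr z)"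
      using assms by (intro mult_left_mono) auto
    finally show ?thesis .
  next
    case False
    then have "a \<le> t / e" using assms by (simp add: field_simps)
    moreover have "t \<le> t / e" using assms t by (simp add: field_simps mult_left_le_one_le)
    ultimately have "z * t * (a + t) powr (z - 1) \<le> z * t * (2 * (t / e)) powr (z - 1)"
      using assms t by (intro mult_left_mono powr_mono2) auto
    also have "\<dots> = z * 2 powr (z - 1) * (e powr (1 - z) * t powr z)"
    proof -
      have "e powr (1 - z) = inverse (e powr (z - 1))"
        by (subst powr_minus[symmetric]) simp
      moreover have "t powr z = t * t powr (z - 1)" using t by (simp add: powr_mult_base)
      moreover have "(2 * (t / e)) powr (z - 1) = 2 powr (z - 1) * (t powr (z - 1) / e powr (z - 1))"
        using assms t by (simp only: powr_mult powr_divide)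
      ultimately show ?thesis by (simp add: divide_inverse)
    qed
    also have "\<dots> \<le> z * 2 powr z * (e powr (1 - z) * t powr z)"
      using assms by (intro mult_right_mono mult_left_mono powr_mono) auto
    also have "\<dots> \<le> z * 2 powr z * (e * a powr z + e powr (1 - z) * t powr z)"
      using assms by (intro mult_left_mono) auto
    finally show ?thesis .
  qed
  finally show ?thesis .
qed

text \<open>\<open>r\<close> and \<open>s\<close> are the legs of a right triangle with hypotenuse
  \<open>q\<close>; the leg \<open>r\<close> is small when \<open>s\<close> is nearly as long as
  \<open>q\<close>. For \<open>z \<ge> 2\<close>, superadditivity at exponent \<open>z / 2\<close>
  on the squares gives \<open>r powr z \<le> q powr z - s powr z\<close>. For \<open>z < 2\<close>,
  either \<open>r \<le> e * q\<close>, or \<open>r\<^sup>2 \<le> 2 * q * (q - s)\<close> is combined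
  with the lower bound \<open>e * q\<close> for \<open>r\<close>. The factor
  \<open>e powr - 3\<close> explains the exponent \<open>z + 3\<close> in the accuracy demanded
  later.\<close>

lemma powr_leg_le:
  fixes q s r e z :: real
  assumes "1 \<le> z" "0 \<le> s" "s \<le> q" "0 \<le> r" "r\<^sup>2 = q\<^sup>2 - s\<^sup>2" "0 < e" "e \<le> 1"
  shows "r powr z \<le> 2 * (e powr z * q powr z + e powr - 3 * (q powr z - s powr z))"
proof -
  define D where "D = q powr z - s powr z"
  have D: "0 \<le> D" unfolding D_def using assms by (simp add: powr_mono2)
  have e3: "1 \<le> e powr - 3"
    using powr_mono'[of "-3" 0 e] assms by simp
  have eq: "0 \<le> e powr z * q powr z" by simp
  consider "2 \<le> z" | "z < 2" "r \<le> e * q" | "z < 2" "e * q < r" by linarith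
  then have "r powr z \<le> e powr z * q powr z + 2 * (e powr - 3 * D)"
  proof cases
    case 1
    have h: "x powr z = (x\<^sup>2) powr (z / 2)" if "0 \<le> x" for x
      using that by (simp add: powr_powr flip: powr_numeral)
    have "(r\<^sup>2) powr (z / 2) + (s\<^sup>2) powr (z / 2) \<le> (r\<^sup>2 + s\<^sup>2) powr (z / 2)"
      using 1 by (intro powr_add_superadditive) auto
    also have "r\<^sup>2 + s\<^sup>2 = q\<^sup>2" using assms by simp
    finally have "r powr z \<le> D" using h assms by (simp add: D_def)
    also have "\<dots> \<le> e powr - 3 * D" using mult_right_mono[OF e3 D] by simp
    finally show ?thesis using eq D e3 by (smt (verit) mult_nonneg_nonneg)
  next
    case 2
    then have "r powr z \<le> (e * q) powr z" using assms by (intro powr_mono2) auto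
    then show ?thesis using assms D by (simp add: powr_mult add_increasing2)
  next
    case 3
    have q: "0 < q"
    proof (rule ccontr)
      assume "\<not> 0 < q"
      then have "q = 0" "s = 0" using assms by auto
      with assms 3 show False by simp
    qed
    then have eq0: "0 < e * q" using assms by simp
    \<comment> \<open>A lower bound for the gap of the powers, from
      \<open>s powr (z - 1) \<le> q powr (z - 1)\<close>.\<close>
    have "(q - s) * q powr (z - 1) \<le> D"
    proof -
      have "s * s powr (z - 1) \<le> s * q powr (z - 1)"
        using assms by (intro mult_left_mono powr_mono2) auto
      then have "s powr z \<le> s * q powr (z - 1)" using assms by (simp add: powr_mult_base)
      moreover have "q powr z = q * q powr (z - 1)" using assms by (simp add: powr_mult_base)
      ultimately show ?thesis by (simp add: D_def left_diff_distrib)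
    qed
    then have *: "2 * q powr (2 - z) * ((q - s) * q powr (z - 1)) \<le> 2 * q powr (2 - z) * D"
      by (intro mult_left_mono) auto
    have "q powr (2 - z) * q powr (z - 1) = q"
      using q by (simp flip: powr_add)
    then have "2 * q powr (2 - z) * ((q - s) * q powr (z - 1)) = 2 * q * (q - s)"
      by (simp add: mult_ac)
    moreover have "r\<^sup>2 \<le> 2 * q * (q - s)"
    proof -
      have "r\<^sup>2 = (q + s) * (q - s)" using assms by (simp add: power2_eq_square algebra_simps)
      also have "\<dots> \<le> 2 * q * (q - s)" using assms by (intro mult_right_mono) auto
      finally show ?thesis .
    qed
    ultimately have r2: "r\<^sup>2 \<le> 2 * q powr (2 - z) * D" using * by linarith
    have "r powr z = r\<^sup>2 * r powr (z - 2)"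
      using eq0 3 by (simp flip: powr_add powr_numeral)
    \<comment> \<open>The exponent \<open>z - 2\<close> is negative here, so the lower bound
      \<open>e * q < r\<close> becomes an upper bound for \<open>r powr (z - 2)\<close>.\<close>
    also have "\<dots> \<le> (2 * q powr (2 - z) * D) * (e * q) powr (z - 2)"
      using r2 eq0 3 by (intro mult_mono powr_mono2') (auto simp: D)
    also have "\<dots> = 2 * D * e powr (z - 2)"
    proof -
      have "q powr (2 - z) * q powr (z - 2) = 1" using q by (simp flip: powr_add)
      then show ?thesis using assms q by (simp add: powr_mult mult_ac)
    qed
    also have "\<dots> \<le> 2 * D * e powr - 3"
      using assms D by (intro mult_left_mono powr_mono') auto
    also have "\<dots> = 2 * (e powr - 3 * D)" by simp
    finally show ?thesis using eq by linarith
  qed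
  then show ?thesis using eq unfolding D_def[symmetric] distrib_left by linarith
qed

subsection \<open>Projections to finite spans\<close>

text \<open>Gram-Schmidt by induction on \<open>B\<close>: \<open>g\<close> is the part of the new
  vector orthogonal to the old span, and the old projection is corrected by a multiple of
  \<open>g\<close>. The induction hypothesis is applied both to \<open>x\<close> and to
  \<open>b\<close>, hence the generalisation over \<open>x\<close>.\<close>

lemma orth_decomp_exists:
  fixes B :: "'a::real_inner set"
  assumes "finite B"
  shows "\<exists>p. p \<in> span B \<and> (\<forall>e\<in>span B. orthogonal (x - p) e)"
  using assms
proof (induction B arbitrary: x)
  case empty
  then show ?case by (intro exI[of _ 0]) (auto simp: orthogonal_def)
next
  case (insert b B)
  obtain p where p: "p \<in> span B" "\<forall>e\<in>span B. orthogonal (x - p) e" using insert by blast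
  obtain a where a: "a \<in> span B" "\<forall>e\<in>span B. orthogonal (b - a) e" using insert by blast
  define g where "g = b - a"
  \<comment> \<open>If \<open>b\<close> already lies in the old span, then \<open>g = 0\<close> and
    division by zero yields \<open>t = 0\<close>, so nothing is corrected.\<close>
  define t where "t = inner (x - p) g / inner g g"
  have g: "g \<in> span (insert b B)" unfolding g_def
    using a span_mono[OF subset_insertI, of B b] by (intro span_diff) (auto intro: span_base)
  have "orthogonal (x - (p + t *\<^sub>R g)) e" if e: "e \<in> span (insert b B)" for e
  proof -
    obtain c where c: "e - c *\<^sub>R b \<in> span B" using e by (auto simp: span_breakdown_eq)
    define f where "f = e - c *\<^sub>R g"
    have f: "f \<in> span B"
    proof -
      have "f = (e - c *\<^sub>R b) + c *\<^sub>R a" by (simp add: f_def g_def algebra_simps)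
      then show ?thesis using c a by (metis span_add span_scale)
    qed
    have "e = f + c *\<^sub>R g" by (simp add: f_def)
    moreover have "inner (x - p) f = 0" "inner g f = 0"
      using p a f by (auto simp: orthogonal_def g_def)
    moreover have "t * inner g g = inner (x - p) g" by (cases "g = 0") (auto simp: t_def)
    ultimately show ?thesis
      by (simp add: orthogonal_def algebra_simps inner_add inner_diff)
  qed
  then show ?case using p g span_mono[OF subset_insertI, of B b]
    by (intro exI[of _ "p + t *\<^sub>R g"]) (auto intro!: span_add span_scale)
qed

lemma orth_proj_span:
  fixes B :: "'a::real_inner set"
  assumes "finite B"
  shows "orth_proj (span B) x \<in> span B"
    and "e \<in> span B \<Longrightarrow> inner (x - orth_proj (span B) x) e = 0"
proof -
  obtain p where p: "p \<in> span B" "\<forall>e\<in>span B. orthogonal (x - p) e"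
    using orth_decomp_exists[OF assms] by blast
  then have "orth_proj (span B) x = p" by (intro orth_proj_eqI) auto
  with p show "orth_proj (span B) x \<in> span B"
    "e \<in> span B \<Longrightarrow> inner (x - orth_proj (span B) x) e = 0"
    by (auto simp: orthogonal_def)
qed

lemma infdist_span:
  fixes B :: "'a::real_inner set"
  assumes "finite B"
  shows "infdist x (span B) = norm (x - orth_proj (span B) x)"
proof (rule antisym)
  let ?p = "orth_proj (span B) x"
  show "infdist x (span B) \<le> norm (x - ?p)"
    using infdist_le[OF orth_proj_span(1)[OF assms]] by (simp add: dist_norm)
  have "norm (x - ?p) \<le> dist x y" if "y \<in> span B" for y
  proof -
    have "?p - y \<in> span B" using that orth_proj_span(1)[OF assms] by (intro span_diff)
    then have "orthogonal (x - ?p) (?p - y)"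
      using orth_proj_span(2)[OF assms] by (simp add: orthogonal_def)
    from norm_add_Pythagorean[OF this] have "(norm (x - ?p))\<^sup>2 \<le> (dist x y)\<^sup>2"
      by (simp add: dist_norm)
    then show ?thesis by (rule power2_le_imp_le) simp
  qed
  then show "norm (x - ?p) \<le> infdist x (span B)"
    using span_zero[of B] by (subst infdist_notempty) (auto intro!: cINF_greatest)
qed

text \<open>Supplies the right triangle for \<open>powr_leg_le\<close>: hypotenuse
  \<open>norm x\<close>, with the projection and the distance to the span as legs.\<close>

lemma norm_orth_proj_span:
  fixes B :: "'a::real_inner set"
  assumes "finite B"
  shows "(norm (orth_proj (span B) x))\<^sup>2 = (norm x)\<^sup>2 - (infdist x (span B))\<^sup>2"
    and "infdist x (span B) \<le> norm x"
proof -
  let ?p = "orth_proj (span B) x"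
  have "orthogonal (x - ?p) ?p"
    using orth_proj_span[OF assms] by (simp add: orthogonal_def)
  from norm_add_Pythagorean[OF this]
  show *: "(norm ?p)\<^sup>2 = (norm x)\<^sup>2 - (infdist x (span B))\<^sup>2"
    by (simp add: infdist_span[OF assms])
  have "(infdist x (span B))\<^sup>2 \<le> (norm x)\<^sup>2" using * by (smt (verit) zero_le_power2)
  then show "infdist x (span B) \<le> norm x" by (rule power2_le_imp_le) simp
qed

text \<open>Every direction of the finite span is nearly orthogonal to \<open>q\<close> when the projection of \<open>q\<close> is
  short, so the law of cosines loses almost nothing.\<close>

lemma abs_sqrt_Pythagoras_defect_le:
  fixes B :: "'a::real_inner set"
  assumes "finite B" "b \<in> span B" "0 \<le> l" "0 \<le> D"
    and D: "D\<^sup>2 = l + (norm (q - b))\<^sup>2"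
  shows "\<bar>D - sqrt (l + (norm q)\<^sup>2 + (norm b)\<^sup>2)\<bar> \<le> 2 * norm (orth_proj (span B) q)"
proof (cases "b = 0")
  \<comment> \<open>Treated separately because the general case ends by cancelling
    \<open>norm b\<close>.\<close>
  case True
  then have "D = sqrt (l + (norm q)\<^sup>2 + (norm b)\<^sup>2)"
    using D assms(4) by (metis add.right_neutral diff_zero norm_zero real_sqrt_unique zero_power2)
  then show ?thesis by simp
next
  case False
  let ?r = "orth_proj (span B) q"
  define E where "E = sqrt (l + (norm q)\<^sup>2 + (norm b)\<^sup>2)"
  have E2: "E\<^sup>2 = l + (norm q)\<^sup>2 + (norm b)\<^sup>2" using assms(3) by (simp add: E_def)
  have Eb: "norm b \<le> E" unfolding E_def using assms(3) by (intro real_le_rsqrt) simp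
  \<comment> \<open>Only the projection of \<open>q\<close> to the span meets \<open>b\<close>. With
    \<open>D\<^sup>2 - E\<^sup>2 = - 2 * inner q b\<close> and \<open>norm b \<le> E\<close>, one
    factor \<open>norm b\<close> cancels.\<close>
  have "inner q b = inner ?r b"
    using orth_proj_span(2)[OF assms(1,2), of q] by (simp add: inner_diff_left)
  then have i: "\<bar>inner q b\<bar> \<le> norm ?r * norm b" using Cauchy_Schwarz_ineq2 by simp
  have "D\<^sup>2 - E\<^sup>2 = - 2 * inner q b"
    unfolding D E2 by (simp add: power2_norm_eq_inner inner_diff inner_commute)
  then have "(D - E) * (D + E) = - 2 * inner q b"
    by (simp add: power2_eq_square algebra_simps)
  then have "\<bar>D - E\<bar> * \<bar>D + E\<bar> \<le> 2 * (norm ?r * norm b)"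
    using i by (simp flip: abs_mult)
  moreover have "\<bar>D - E\<bar> * norm b \<le> \<bar>D - E\<bar> * \<bar>D + E\<bar>"
    using Eb assms(4) by (intro mult_left_mono) auto
  ultimately have "\<bar>D - E\<bar> * norm b \<le> (2 * norm ?r) * norm b" by simp
  then show ?thesis using False unfolding E_def[symmetric] by simp
qed

lemma infdist_image_perturb:
  assumes "C \<noteq> {}" "\<And>c. c \<in> C \<Longrightarrow> \<bar>dist x c - dist x (f c)\<bar> \<le> t"
  shows "\<bar>infdist x C - infdist x (f ` C)\<bar> \<le> t"
proof -
  have "infdist x C - t \<le> infdist x (f ` C)"
    unfolding infdist_notempty[of "f ` C", simplified, OF assms(1)]
  proof (rule cINF_greatest)
    fix y assume "y \<in> f ` C"
    then obtain c where "c \<in> C" "y = f c" by blast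
    then show "infdist x C - t \<le> dist x y" using assms(2)[of c] infdist_le[of c C x] by auto
  qed (use assms in auto)
  moreover have "infdist x (f ` C) - t \<le> infdist x C"
    unfolding infdist_notempty[OF assms(1)]
  proof (rule cINF_greatest)
    fix c assume "c \<in> C"
    then show "infdist x (f ` C) - t \<le> dist x c" using assms(2)[of c] infdist_le[of "f c" "f ` C" x] by auto
  qed (use assms in auto)
  ultimately show ?thesis by linarith
qed

subsection \<open>Moving centers into one extra dimension\<close>

text \<open>A center and its lifted copy have the same projection to \<open>span B\<close> and
  orthogonal parts of equal length. If all inner products with \<open>q x\<close> vanished, both
  would be at the same distance \<open>?E\<close> from \<open>x\<close>; each true distance is
  compared with \<open>?E\<close>.\<close>

lemma infdist_lifted_centers:
  fixes B C :: "'a::real_inner set"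
  assumes "finite B" "finite C" "C \<noteq> {}" "norm u = 1" and u: "\<And>e. e \<in> span B \<Longrightarrow> inner u e = 0"
  defines "q \<equiv> \<lambda>x. x - orth_proj (span B) x"
  shows "\<bar>infdist x C - infdist x ((\<lambda>c. orth_proj (span B) c + norm (q c) *\<^sub>R u) ` C)\<bar>
    \<le> 2 * (norm (orth_proj (span (q ` C)) (q x)) + norm (orth_proj (span {u}) (q x)))"
proof (rule infdist_image_perturb)
  fix c assume c: "c \<in> C"
  let ?p = "orth_proj (span B)"
  let ?l = "(norm (?p x - ?p c))\<^sup>2"
  let ?b = "norm (q c) *\<^sub>R u"
  let ?E = "sqrt (?l + (norm (q x))\<^sup>2 + (norm (q c))\<^sup>2)"
  have pp: "?p x - ?p c \<in> span B" using assms(1) by (intro span_diff orth_proj_span)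
  have qe: "inner (q y) e = 0" if "e \<in> span B" for y e
    using orth_proj_span(2)[OF assms(1) that] by (simp add: q_def)
  \<comment> \<open>Taken at \<open>g = q c\<close> for the original center, and at
    \<open>g = ?b\<close> for the lifted one.\<close>
  have pyth: "(dist x (?p c + g))\<^sup>2 = ?l + (norm (q x - g))\<^sup>2"
    if "\<And>e. e \<in> span B \<Longrightarrow> inner g e = 0" for g
  proof -
    have "x - (?p c + g) = (?p x - ?p c) + (q x - g)" by (simp add: q_def)
    moreover have "orthogonal (?p x - ?p c) (q x - g)"
      using that[OF pp] qe[OF pp, of x]
      by (metis diff_zero inner_commute inner_diff_left orthogonal_def)
    ultimately show ?thesis by (simp only: dist_norm norm_add_Pythagorean)
  qed
  have "\<bar>dist x c - ?E\<bar> \<le> 2 * norm (orth_proj (span (q ` C)) (q x))"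
  proof (rule abs_sqrt_Pythagoras_defect_le)
    show "(dist x c)\<^sup>2 = ?l + (norm (q x - q c))\<^sup>2"
      using pyth[of "q c"] qe by (simp add: q_def)
    show "q c \<in> span (q ` C)" using c by (intro span_base) auto
  qed (use assms(2) in auto)
  moreover have "\<bar>dist x (?p c + ?b) - sqrt (?l + (norm (q x))\<^sup>2 + (norm ?b)\<^sup>2)\<bar>
      \<le> 2 * norm (orth_proj (span {u}) (q x))"
  proof (rule abs_sqrt_Pythagoras_defect_le)
    show "(dist x (?p c + ?b))\<^sup>2 = ?l + (norm (q x - ?b))\<^sup>2"
      using u by (intro pyth) simp
    show "?b \<in> span {u}" by (intro span_scale span_base) simp
  qed auto
  moreover have "norm ?b = norm (q c)" using assms(4) by simp
  moreover have "\<bar>s - t\<bar> \<le> 2 * (m + n)" if "\<bar>s - r\<bar> \<le> 2 * m" "\<bar>t - r\<bar> \<le> 2 * n" for r s t m n :: real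
    using that by (auto simp: abs_le_iff)
  ultimately show "\<bar>dist x c - dist x (?p c + ?b)\<bar>
      \<le> 2 * (norm (orth_proj (span (q ` C)) (q x)) + norm (orth_proj (span {u}) (q x)))"
    by (simp only:)
qed (use assms in auto)

text \<open>Sums \<open>powr_leg_le\<close> over the residuals \<open>q x\<close>: if
  \<open>span H\<close> captures little of their cost, their projections to it are short on average.
  \<open>M\<close> stands for the optimum, and \<open>14 = 2 * (3 + 4)\<close>.\<close>

lemma sum_norm_orth_proj_powr_le:
  fixes H :: "'a::real_inner set"
  assumes "finite H" "1 \<le> z" "0 < e" "e \<le> 1" "\<And>x. x \<in> Y \<Longrightarrow> 0 \<le> w x"
    and W: "(\<Sum>x\<in>Y. w x * norm (q x) powr z) \<le> 3 * M"
    and D: "(\<Sum>x\<in>Y. w x * norm (q x) powr z) - (\<Sum>x\<in>Y. w x * dist_pow z (q x) (span H))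
      \<le> 4 * e powr (z + 3) * M"
  shows "(\<Sum>x\<in>Y. w x * norm (orth_proj (span H) (q x)) powr z) \<le> 14 * e powr z * M"
proof -
  have "(\<Sum>x\<in>Y. w x * norm (orth_proj (span H) (q x)) powr z)
    \<le> (\<Sum>x\<in>Y. w x * (2 * (e powr z * norm (q x) powr z
        + e powr - 3 * (norm (q x) powr z - dist_pow z (q x) (span H)))))"
    using assms norm_orth_proj_span[OF assms(1)] unfolding dist_pow_def
    by (intro sum_mono mult_left_mono powr_leg_le) (auto simp: infdist_nonneg)
  also have "\<dots> = 2 * (e powr z * (\<Sum>x\<in>Y. w x * norm (q x) powr z)
      + e powr - 3 * ((\<Sum>x\<in>Y. w x * norm (q x) powr z) - (\<Sum>x\<in>Y. w x * dist_pow z (q x) (span H))))"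
    by (simp add: sum_distrib_left sum.distrib sum_subtractf algebra_simps)
  also have "\<dots> \<le> 2 * (e powr z * (3 * M) + e powr - 3 * (4 * e powr (z + 3) * M))"
    using W D by (intro mult_left_mono add_mono) auto
  also have "e powr - 3 * (4 * e powr (z + 3) * M) = 4 * e powr z * M"
  proof -
    have "e powr - 3 * e powr (z + 3) = e powr z" using assms(3) by (simp flip: powr_add)
    then show ?thesis by (simp add: mult_ac)
  qed
  finally show ?thesis by (simp add: algebra_simps)
qed

text \<open>Weights are general so that both the dataset and the coreset are covered. The error is
  measured against the original cost (for the dataset, where that cost is at least the optimum) and
  against the lifted cost (for the coreset, where only the lifted cost is controlled so
  far).\<close>

lemma wcost_lifted_centers:
  fixes B C Y :: "'a::real_inner set" and z e M :: real
  assumes BC: "finite B" "finite C" "C \<noteq> {}" "norm u = 1" "\<And>e. e \<in> span B \<Longrightarrow> inner u e = 0"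
    and zew: "1 \<le> z" "0 < e" "e \<le> 1" "\<And>x. x \<in> Y \<Longrightarrow> 0 \<le> w x"
  defines "q \<equiv> \<lambda>x. x - orth_proj (span B) x"
  defines "f \<equiv> \<lambda>c. orth_proj (span B) c + norm (q c) *\<^sub>R u"
  assumes W: "(\<Sum>x\<in>Y. w x * norm (q x) powr z) \<le> 3 * M"
    and D: "\<And>H. H \<in> {q ` C, {u}} \<Longrightarrow>
      (\<Sum>x\<in>Y. w x * norm (q x) powr z) - (\<Sum>x\<in>Y. w x * dist_pow z (q x) (span H))
        \<le> 4 * e powr (z + 3) * M"
  shows "\<bar>wcost z Y w C - wcost z Y w (f ` C)\<bar> \<le> z * 2 powr z * (28 * 4 powr z) * e * (wcost z Y w C + M)"
    and "\<bar>wcost z Y w C - wcost z Y w (f ` C)\<bar> \<le> z * 2 powr z * (28 * 4 powr z) * e * (wcost z Y w (f ` C) + M)"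
proof -
  define r where "r H x = norm (orth_proj (span H) (q x))" for H x
  define t where "t x = 2 * (r (q ` C) x + r {u} x)" for x
  define L where "L = z * 2 powr z"
  have L: "0 \<le> L" using zew by (simp add: L_def)
  have W0: "0 \<le> wcost z Y w A" for A
    unfolding wcost_def using zew by (intro sum_nonneg) (auto simp: dist_pow_def)
  have t: "\<bar>infdist x C - infdist x (f ` C)\<bar> \<le> t x" for x
    using infdist_lifted_centers[OF BC, of x] by (simp add: t_def r_def f_def q_def)
  \<comment> \<open>One \<open>2 powr z\<close> comes from the factor 2 in \<open>t\<close>, the
    other from splitting the sum.\<close>
  have "t x powr z \<le> 4 powr z * (r (q ` C) x powr z + r {u} x powr z)" for x
  proof -
    have "t x powr z = 2 powr z * (r (q ` C) x + r {u} x) powr z"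
      unfolding t_def by (rule powr_mult)
    also have "\<dots> \<le> 2 powr z * (2 powr z * (r (q ` C) x powr z + r {u} x powr z))"
      using zew by (intro mult_left_mono powr_add_le_sum) (auto simp: r_def)
    finally show ?thesis by (simp flip: mult.assoc powr_mult)
  qed
  then have "(\<Sum>x\<in>Y. w x * t x powr z)
      \<le> (\<Sum>x\<in>Y. w x * (4 powr z * (r (q ` C) x powr z + r {u} x powr z)))"
    using zew by (intro sum_mono mult_left_mono) auto
  also have "\<dots> = 4 powr z * ((\<Sum>x\<in>Y. w x * r (q ` C) x powr z) + (\<Sum>x\<in>Y. w x * r {u} x powr z))"
    by (simp add: sum_distrib_left sum.distrib algebra_simps)
  also have "\<dots> \<le> 4 powr z * (14 * e powr z * M + 14 * e powr z * M)"
    unfolding r_def using BC zew W D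
    by (intro mult_left_mono add_mono sum_norm_orth_proj_powr_le) auto
  finally have T: "(\<Sum>x\<in>Y. w x * t x powr z) \<le> 28 * 4 powr z * e powr z * M" by (simp add: mult_ac)
  \<comment> \<open>\<open>powr_perturb\<close> is asymmetric in its two distances, so the estimate
    is proved for a general pair and used in both orders. The \<open>e powr z\<close> gained for the
    projections absorbs \<open>e powr (1 - z)\<close> and leaves one factor
    \<open>e\<close>.\<close>
  have main: "\<bar>wcost z Y w A - wcost z Y w A'\<bar> \<le> L * (28 * 4 powr z) * e * (wcost z Y w A + M)"
    if AA: "\<And>x. \<bar>infdist x A - infdist x A'\<bar> \<le> t x" for A A'
  proof -
    have "\<bar>wcost z Y w A - wcost z Y w A'\<bar> \<le> (\<Sum>x\<in>Y. \<bar>w x * (dist_pow z x A - dist_pow z x A')\<bar>)"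
      unfolding wcost_def by (simp add: right_diff_distrib flip: sum_subtractf)
    also have "\<dots> \<le> (\<Sum>x\<in>Y. w x * (L * (e * dist_pow z x A + e powr (1 - z) * t x powr z)))"
      using zew AA unfolding dist_pow_def L_def
      by (intro sum_mono) (auto simp: abs_mult infdist_nonneg intro!: mult_left_mono powr_perturb)
    also have "\<dots> = L * (e * wcost z Y w A + e powr (1 - z) * (\<Sum>x\<in>Y. w x * t x powr z))"
      unfolding wcost_def by (simp add: sum_distrib_left sum.distrib algebra_simps)
    also have "\<dots> \<le> L * (28 * 4 powr z * e * wcost z Y w A + e powr (1 - z) * (28 * 4 powr z * e powr z * M))"
    proof (intro mult_left_mono add_mono T L)
      have "1 \<le> (4::real) powr z" using zew by (intro ge_one_powr_ge_zero) auto
      then have "1 * e \<le> 28 * 4 powr z * e" using zew by (intro mult_right_mono) auto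
      then show "e * wcost z Y w A \<le> 28 * 4 powr z * e * wcost z Y w A"
        using W0 by (intro mult_right_mono) auto
    qed auto
    also have "e powr (1 - z) * (28 * 4 powr z * e powr z * M) = 28 * 4 powr z * e * M"
    proof -
      have "e powr (1 - z) * e powr z = e" using zew by (simp flip: powr_add)
      then show ?thesis by (simp add: mult_ac)
    qed
    finally show ?thesis by (simp add: algebra_simps)
  qed
  show "\<bar>wcost z Y w C - wcost z Y w (f ` C)\<bar> \<le> z * 2 powr z * (28 * 4 powr z) * e * (wcost z Y w C + M)"
    using main[OF t] by (simp add: L_def)
  have "\<bar>wcost z Y w (f ` C) - wcost z Y w C\<bar> \<le> L * (28 * 4 powr z) * e * (wcost z Y w (f ` C) + M)"
    using t by (intro main) (simp add: abs_minus_commute)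
  then show "\<bar>wcost z Y w C - wcost z Y w (f ` C)\<bar> \<le> z * 2 powr z * (28 * 4 powr z) * e * (wcost z Y w (f ` C) + M)"
    by (simp add: L_def abs_minus_commute)
qed

text \<open>Follows the chain from \<open>a\<close> through \<open>a'\<close> and \<open>b'\<close>
  to \<open>b\<close>. Since \<open>M \<le> a\<close>, all additive errors become relative to
  \<open>a\<close>; the three links contribute 2, 3 and 7. The square of \<open>K\<close> arises
  because \<open>b'\<close> is itself bounded only by a multiple of \<open>K * a\<close>.\<close>

lemma approx_trans_perturb:
  fixes a a' b b' e K M :: real
  assumes "0 \<le> e" "e \<le> 1" "1 \<le> K" "0 \<le> M" "M \<le> a"
    and a: "\<bar>a - a'\<bar> \<le> K * e * (a + M)" and ab: "approx e a' b'"
    and b: "\<bar>b - b'\<bar> \<le> K * e * (b' + M)"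
  shows "approx (12 * K\<^sup>2 * e) a b"
proof -
  have Ke: "0 \<le> K * e" "K * e \<le> K" "e \<le> K * e" "K \<le> K\<^sup>2"
    using assms mult_left_mono[of e 1 K] mult_right_mono[of 1 K e] mult_left_mono[of 1 K K]
    by (auto simp: power2_eq_square)
  have a0: "0 \<le> a" using assms by simp
  have 1: "\<bar>a - a'\<bar> \<le> 2 * K * e * a"
  proof -
    have "K * e * (a + M) \<le> K * e * (a + a)" using assms Ke by (intro mult_left_mono) auto
    with a show ?thesis by (simp add: algebra_simps)
  qed
  have a'0: "a' \<le> 3 * K * a"
  proof -
    have "K * e * a \<le> K * a" "1 * a \<le> K * a" using Ke a0 assms(3) by (rule_tac [!] mult_right_mono)
    with 1 show ?thesis by linarith
  qed
  have 2: "\<bar>b' - a'\<bar> \<le> e * a'" using ab by (auto simp: approx_def algebra_simps)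
  have 3: "e * a' \<le> 3 * K * e * a" using mult_left_mono[OF a'0 assms(1)] by (simp add: algebra_simps)
  have a'1: "0 \<le> e * a'" using 2 by linarith
  have 4: "b' \<le> 6 * K * a"
  proof -
    have "K * e * a \<le> K * a" using Ke a0 by (intro mult_right_mono) auto
    then show ?thesis using 2 3 a'0 by linarith
  qed
  have "M \<le> K * a" using mult_right_mono[OF assms(3) a0] assms by simp
  then have "b' + M \<le> 7 * K * a" using 4 by linarith
  then have "K * e * (b' + M) \<le> K * e * (7 * K * a)" using Ke by (intro mult_left_mono) auto
  then have 5: "\<bar>b - b'\<bar> \<le> 7 * K\<^sup>2 * e * a" using b by (simp add: power2_eq_square mult_ac)
  have "K * (e * a) \<le> K\<^sup>2 * (e * a)" using Ke a0 assms by (intro mult_right_mono) auto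
  then have "2 * K * e * a + 3 * K * e * a + 7 * K\<^sup>2 * e * a \<le> 12 * K\<^sup>2 * e * a" by (simp add: mult_ac)
  then have "\<bar>b - a\<bar> \<le> 12 * K\<^sup>2 * e * a" using 1 2 3 5 by linarith
  then show ?thesis by (auto simp: approx_def algebra_simps)
qed

subsection \<open>Optimal costs and the greedy subspace\<close>

lemma dist_pow_nonneg [simp]: "0 \<le> dist_pow z x A"
  by (simp add: dist_pow_def)

lemma cost_nonneg [simp]: "0 \<le> cost z X A"
  by (simp add: cost_def sum_nonneg)

lemma cost_eq_wcost: "cost z X = wcost z X (\<lambda>_. 1)"
  by (simp add: fun_eq_iff cost_def wcost_def)

lemma cost_antimono:
  assumes "0 \<le> z" "A \<subseteq> A'" "A \<noteq> {}"
  shows "cost z X A' \<le> cost z X A"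
  unfolding cost_def dist_pow_def using assms
  by (intro sum_mono powr_mono2 infdist_mono) (auto simp: infdist_nonneg)

lemma opt_cost_le: "C \<in> center_tuples k V \<Longrightarrow> opt_cost k z V X \<le> cost z X (set C)"
  unfolding opt_cost_def by (rule cINF_lower) (auto intro: bdd_belowI2[of _ 0])

lemma center_tuples_nonempty: "a \<in> V \<Longrightarrow> center_tuples k V \<noteq> {}"
  by (auto simp: center_tuples_def intro!: exI[of _ "replicate k a"])

lemma opt_cost_nonneg: "a \<in> V \<Longrightarrow> 0 \<le> opt_cost k z V X"
  unfolding opt_cost_def by (intro cINF_greatest center_tuples_nonempty) auto

text \<open>Pigeonhole: two points of \<open>X\<close> share a nearest center, and one of them is at least half the
  minimal distance in \<open>X\<close> away from it.\<close>

lemma opt_cost_pos: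
  fixes X :: "'a::metric_space set"
  assumes "finite X" "k < card X" "1 \<le> k" "0 \<le> z" "a \<in> V"
  shows "0 < opt_cost k z V X"
proof -
  define D where "D = (\<lambda>(x, y). dist x y) ` {(x, y) \<in> X \<times> X. x \<noteq> y}"
  have "finite D" unfolding D_def
    using assms(1) by (intro finite_imageI) (auto intro: finite_subset[of _ "X \<times> X"])
  obtain m where m: "0 < m" "\<And>x y. x \<in> X \<Longrightarrow> y \<in> X \<Longrightarrow> x \<noteq> y \<Longrightarrow> m \<le> dist x y"
  proof (cases "D = {}")
    case True
    then show ?thesis by (intro that[of 1]) (auto simp: D_def)
  next
    case False
    show ?thesis
    proof (rule that[of "Min D"])
      show "0 < Min D" using \<open>finite D\<close> False by (subst Min_gr_iff) (auto simp: D_def)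
      show "Min D \<le> dist x y" if "x \<in> X" "y \<in> X" "x \<noteq> y" for x y
        using \<open>finite D\<close> that by (intro Min_le) (auto simp: D_def)
    qed
  qed
  have "(m / 2) powr z \<le> cost z X (set C)" if C: "C \<in> center_tuples k V" for C
  proof -
    have len: "length C = k" using C by (simp add: center_tuples_def)
    then have "set C \<noteq> {}" using assms(3) by auto
    then have "\<exists>c\<in>set C. dist x c = infdist x (set C)" for x
      using Min_in[of "dist x ` set C"] by (fastforce simp: infdist_notempty cInf_eq_Min)
    then obtain f where f: "\<And>x. f x \<in> set C" "\<And>x. dist x (f x) = infdist x (set C)" by metis
    have "card (f ` X) \<le> card (set C)" using f by (intro card_mono) auto
    also have "\<dots> < card X" using card_length[of C] len assms(2) by simp
    finally obtain x y where xy: "x \<in> X" "y \<in> X" "x \<noteq> y" "f x = f y"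
      using pigeonhole[of f X] by (auto simp: inj_on_def)
    have "m \<le> dist x (f x) + dist y (f x)"
      using m(2)[OF xy(1-3)] dist_triangle2[of x y "f x"] by linarith
    then have "m \<le> infdist x (set C) + infdist y (set C)" using f(2)[of x] f(2)[of y] xy(4) by simp
    then have "m / 2 \<le> infdist x (set C) \<or> m / 2 \<le> infdist y (set C)" by linarith
    then obtain u where u: "u \<in> X" "m / 2 \<le> infdist u (set C)" using xy by blast
    then have "(m / 2) powr z \<le> dist_pow z u (set C)"
      unfolding dist_pow_def using m assms by (intro powr_mono2) auto
    also have "\<dots> \<le> cost z X (set C)"
      unfolding cost_def using assms(1) u by (intro member_le_sum) auto
    finally show ?thesis .
  qed
  \<comment> \<open>The lower bound does not depend on \<open>C\<close>, so it survives the
    infimum.\<close>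
  then have "(m / 2) powr z \<le> opt_cost k z V X"
    unfolding opt_cost_def using assms by (intro cINF_greatest center_tuples_nonempty) auto
  moreover have "0 < (m / 2) powr z" using m by simp
  ultimately show ?thesis by linarith
qed

text \<open>Every unsaturated set can be enlarged by at most \<open>k\<close> vectors with a gain of
  more than \<open>e\<close> times the optimum. Starting from at most twice the optimum, more than
  \<open>2 / e\<close> such rounds would make the cost negative.\<close>

lemma saturated_span_exists:
  fixes X V :: "'a::real_inner set"
  assumes "finite X" "X \<subseteq> V" "subspace V" "1 \<le> k" "0 \<le> z" "0 < e"
  obtains B where "finite B" "B \<subseteq> V" "real (card B) \<le> real k * (2 / e + 3)"
    "cost z X (span B) \<le> 2 * opt_cost k z V X"
    "\<And>P. finite P \<Longrightarrow> P \<subseteq> V \<Longrightarrow> card P \<le> k \<Longrightarrow>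
      cost z X (span B) - cost z X (span (B \<union> P)) \<le> e * opt_cost k z V X"
proof -
  note witness = that
  have zero: "0 \<in> V" using assms(3) by (rule subspace_0)
  show thesis
  proof (cases "card X \<le> k")
    case True
    have "infdist x (span X) = 0" if "x \<in> X" for x
      using infdist_le[OF span_base[OF that], of x] infdist_nonneg[of x "span X"] by simp
    then have 0: "cost z X (span X) = 0" by (simp add: cost_def dist_pow_def)
    show thesis
    proof (rule that[of X])
      have "real (card X) \<le> real k * 1" using True by simp
      also have "\<dots> \<le> real k * (2 / e + 3)" using assms by (intro mult_left_mono) auto
      finally show "real (card X) \<le> real k * (2 / e + 3)" .
      fix P
      show "cost z X (span X) - cost z X (span (X \<union> P)) \<le> e * opt_cost k z V X"
        using mult_nonneg_nonneg[OF _ opt_cost_nonneg[OF zero], of e k z X] assms(6)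
          cost_nonneg[of z X "span (X \<union> P)"] unfolding 0 by linarith
    qed (use assms opt_cost_nonneg[OF zero, of k z X] 0 in auto)
  next
    case False
    define M where "M = opt_cost k z V X"
    have M: "0 < M" unfolding M_def using False assms zero by (intro opt_cost_pos) auto
    \<comment> \<open>Positivity of \<open>M\<close> gives \<open>M < 2 * M\<close>, so the infimum
      need not be attained to provide a starting set.\<close>
    have "\<exists>C\<in>center_tuples k V. cost z X (set C) < 2 * M"
      using M center_tuples_nonempty[OF zero] unfolding M_def opt_cost_def
      by (subst cINF_less_iff[symmetric]) (auto intro: bdd_belowI2[of _ 0])
    then obtain C where C: "C \<in> center_tuples k V" "cost z X (set C) < 2 * M" by blast
    show thesis
    proof (rule ccontr)
      assume no: "\<not> thesis"
      have step: "\<exists>P. finite P \<and> P \<subseteq> V \<and> card P \<le> k \<and>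
          e * M < cost z X (span B) - cost z X (span (B \<union> P))"
        if "finite B" "B \<subseteq> V" "real (card B) \<le> real k * (2 / e + 3)" "cost z X (span B) \<le> 2 * M" for B
        using that no witness[of B] unfolding M_def by force
      have "\<exists>B. finite B \<and> B \<subseteq> V \<and> card B \<le> k * (m + 1) \<and> cost z X (span B) \<le> 2 * M - m * (e * M)"
        if "real m \<le> 2 / e + 2" for m
        using that
      proof (induction m)
        case 0
        have "set C \<noteq> {}" using C(1) assms(4) by (auto simp: center_tuples_def)
        then have "cost z X (span (set C)) \<le> cost z X (set C)"
          using assms by (intro cost_antimono span_superset) auto
        with C show ?case
          by (intro exI[of _ "set C"]) (auto simp: center_tuples_def card_length)
      next
        case (Suc m)
        then obtain B where B: "finite B" "B \<subseteq> V" "card B \<le> k * (m + 1)"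
          "cost z X (span B) \<le> 2 * M - m * (e * M)" by auto
        have "real (card B) \<le> real k * (real m + 1)" using B(3) by (metis of_nat_1 of_nat_add of_nat_le_iff of_nat_mult)
        also have "\<dots> \<le> real k * (2 / e + 3)" using Suc.prems by (intro mult_left_mono) auto
        finally have "real (card B) \<le> real k * (2 / e + 3)" .
        moreover have "cost z X (span B) \<le> 2 * M"

          using B(4) mult_nonneg_nonneg[of "real m" "e * M"] M assms(6) by (smt (verit) mult_pos_pos of_nat_0_le_iff)
        ultimately obtain P where P: "finite P" "P \<subseteq> V" "card P \<le> k"
          "e * M < cost z X (span B) - cost z X (span (B \<union> P))"
          using step B by blast
        have "card (B \<union> P) \<le> k * (Suc m + 1)" using card_Un_le[of B P] B(3) P(3) by simp
        moreover have "cost z X (span (B \<union> P)) \<le> 2 * M - Suc m * (e * M)"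
          using B(4) P(4) by (simp add: algebra_simps)
        ultimately show ?case using B P by (intro exI[of _ "B \<union> P"]) auto
      qed
      \<comment> \<open>Enough rounds to exceed \<open>2 / e\<close>, yet within the range of the
        induction.\<close>
      moreover define m where "m = nat \<lfloor>2 / e\<rfloor> + 1"
      moreover have "real m = of_int \<lfloor>2 / e\<rfloor> + 1" using assms(6) by (simp add: m_def)
      then have m: "2 / e < real m" "real m \<le> 2 / e + 1" by linarith+
      moreover have "real m \<le> 2 / e + 2" using m by simp
      ultimately obtain B where "cost z X (span B) \<le> 2 * M - m * (e * M)" by blast
      moreover have "2 * M < m * (e * M)"
        using m(1) M assms(6) by (simp add: field_simps)
      ultimately show False using cost_nonneg[of z X "span B"] by linarith
    qed
  qed
qed

section \<open>Subspaces of \<open>Rd d\<close> and infima over them\<close>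

lemma Rd_eq_span: "Rd d = span (unit ` {..<d})"
proof (rule antisym)
  show "span (unit ` {..<d}) \<subseteq> Rd d"
    by (intro span_minimal subspace_Rd) (auto simp: Rd_def)
  show "Rd d \<subseteq> span (unit ` {..<d})"
  proof
    fix x assume x: "x \<in> Rd d"
    have "x = (\<Sum>i<d. coord x i *\<^sub>R unit i)"
      using x by (intro fseq_eqI)
        (auto simp: Rd_def if_distrib[of "\<lambda>a. _ * a"] not_less[symmetric] cong: if_cong)
    also have "\<dots> \<in> span (unit ` {..<d})"
      by (intro span_sum span_scale span_base) auto
    finally show "x \<in> span (unit ` {..<d})" .
  qed
qed

text \<open>The ambient type is infinite-dimensional; the basis is finite because it is independent
  inside the span of \<open>d\<close> unit vectors.\<close>

lemma finite_basis_exists_Rd: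
  assumes "subspace P" "P \<subseteq> Rd d"
  obtains B where "finite B" "card B = dim P" "span B = P"
proof -
  obtain B where B: "B \<subseteq> P" "independent B" "P \<subseteq> span B" "card B = dim P"
    by (rule basis_exists)
  moreover have "finite B"
    using independent_span_bound[of "unit ` {..<d}" B] B assms by (auto simp: Rd_eq_span)
  moreover have "span B = P" using B assms by (metis span_minimal subset_antisym)
  ultimately show thesis using that by blast
qed

text \<open>A vector of \<open>Rd (Suc d)\<close> orthogonal to \<open>Rd d\<close> is a multiple of
  the last unit vector, so subtracting a multiple of it clears the last coordinate of any
  \<open>x\<close>. Needed when the greedy span is the whole space.\<close>

lemma span_insert_hyperplane:
  assumes v: "v \<in> Rd (Suc d) \<inter> (Rd d)\<^sup>\<bottom>" "v \<noteq> 0"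
  shows "span (insert v (Rd d)) = Rd (Suc d)"
proof (rule antisym)
  show "span (insert v (Rd d)) \<subseteq> Rd (Suc d)"
    using v by (intro span_minimal subspace_Rd) (auto simp: Rd_def)
  have low: "coord v i = 0" if "i < d" for i
  proof -
    have u: "unit i \<in> Rd d" using that by (auto simp: Rd_def)
    with v have "inner (unit i) v = 0" by (auto simp: orthogonal_comp_def orthogonal_def)
    moreover have "inner (unit i) v = coord v i"
      using inner_Rd[OF u, of v] that by (simp add: if_distrib[of "\<lambda>a. a * _"] cong: if_cong)
    ultimately show ?thesis by simp
  qed
  have t: "coord v d \<noteq> 0"
  proof
    assume "coord v d = 0"
    then have "coord v i = 0" for i
      using low[of i] v by (cases i d rule: linorder_cases) (auto simp: Rd_def)
    then show False using v(2) by (metis coord_simps(1) fseq_eqI)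
  qed
  show "Rd (Suc d) \<subseteq> span (insert v (Rd d))"
  proof
    fix x assume x: "x \<in> Rd (Suc d)"
    have "x - (coord x d / coord v d) *\<^sub>R v \<in> Rd d"
      unfolding Rd_def
    proof safe
      fix i assume "d \<le> i"
      then consider "i = d" | "Suc d \<le> i" by linarith
      then show "coord (x - (coord x d / coord v d) *\<^sub>R v) i = 0"
        using x v t by cases (auto simp: Rd_def)
    qed
    then show "x \<in> span (insert v (Rd d))"
      unfolding span_breakdown_eq using span_base by blast
  qed
qed

lemma opt_subspace_le:
  assumes "subspace P" "P \<subseteq> E" "dim P \<le> k" "\<And>x. x \<in> Y \<Longrightarrow> 0 \<le> w x"
  shows "opt_subspace k z E f Y w \<le> (\<Sum>x\<in>Y. w x * dist_pow z (f x) P)"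
  unfolding opt_subspace_def using assms
  by (intro cINF_lower bdd_belowI2[of _ 0]) (auto intro!: sum_nonneg)

lemma opt_subspace_ge:
  fixes E :: "'a::real_inner set"
  assumes "0 \<in> E"
    and "\<And>P. subspace P \<Longrightarrow> P \<subseteq> E \<Longrightarrow> dim P \<le> k \<Longrightarrow> m \<le> (\<Sum>x\<in>Y. w x * dist_pow z (f x) P)"
  shows "m \<le> opt_subspace k z E f Y w"
  unfolding opt_subspace_def
proof (rule cINF_greatest)
  \<comment> \<open>The zero subspace keeps the index set of the infimum nonempty.\<close>
  have "{0} \<in> {P. subspace P \<and> P \<subseteq> E \<and> dim P \<le> k}"
    using assms(1) dim_le_card[of "{0 :: 'a}" "{}"] by simp
  then show "{P. subspace P \<and> P \<subseteq> E \<and> dim P \<le> k} \<noteq> {}" by blast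
qed (use assms in auto)

lemma coreset_mono:
  assumes "coreset e k z V X S w" "e \<le> e'"
  shows "coreset e' k z V X S w"
  unfolding coreset_def
proof
  fix C assume "C \<in> center_tuples k V"
  with assms(1) have "approx e (cost z X (set C)) (wcost z S w (set C))"
    by (auto simp: coreset_def)
  moreover have "e * cost z X (set C) \<le> e' * cost z X (set C)"
    using assms(2) by (intro mult_right_mono) auto
  ultimately show "approx e' (cost z X (set C)) (wcost z S w (set C))"
    by (auto simp: approx_def algebra_simps)
qed

subsection \<open>The coreset property\<close>

text \<open>Identifies the projection used in the weak-coreset hypothesis with the residual
  \<open>x - orth_proj (span B) x\<close> of the geometric estimates.\<close>

lemma orth_proj_orthogonal_comp:
  assumes "finite B" "B \<subseteq> Rd d" "x \<in> Rd d"
  shows "x - orth_proj (span B) x \<in> Rd d \<inter> (span B)\<^sup>\<bottom>"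
    and "orth_proj (Rd d \<inter> (span B)\<^sup>\<bottom>) x = x - orth_proj (span B) x"
proof -
  have "span B \<subseteq> Rd d" using assms(2) by (intro span_minimal subspace_Rd)
  then show *: "x - orth_proj (span B) x \<in> Rd d \<inter> (span B)\<^sup>\<bottom>"
    using assms orth_proj_span(1)[OF assms(1), of x] orth_proj_span(2)[OF assms(1), of _ x]
    by (auto simp: orthogonal_comp_def orthogonal_def inner_commute intro!: subspace_diff[OF subspace_Rd])
  show "orth_proj (Rd d \<inter> (span B)\<^sup>\<bottom>) x = x - orth_proj (span B) x"
    using * orth_proj_span(1)[OF assms(1), of x]
    by (intro orth_proj_eqI subspace_inter subspace_Rd subspace_orthogonal_comp)
      (auto simp: orthogonal_comp_def)
qed

lemma dist_pow_span:
  fixes B :: "'a::real_inner set"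
  assumes "finite B"
  shows "dist_pow z x (span B) = norm (x - orth_proj (span B) x) powr z"
  by (simp add: dist_pow_def infdist_span[OF assms])

text \<open>Turns saturation into a statement about residuals: adding the projection of
  \<open>x\<close> to a point of \<open>P\<close> gives a point of the enlarged span, so the
  residual is at least as far from \<open>P\<close> as \<open>x\<close> is from that span.\<close>

lemma cost_saturated_le:
  assumes B: "finite B" "B \<subseteq> Rd d" and "0 \<le> z"
    and sat: "\<And>P. finite P \<Longrightarrow> P \<subseteq> Rd d \<Longrightarrow> card P \<le> k \<Longrightarrow>
      cost z X (span B) - cost z X (span (B \<union> P)) \<le> m"
    and P: "subspace P" "P \<subseteq> Rd d" "dim P \<le> k"
  shows "cost z X (span B) - m \<le> (\<Sum>x\<in>X. dist_pow z (x - orth_proj (span B) x) P)"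
proof -
  obtain A where A: "finite A" "card A = dim P" "span A = P"
    using finite_basis_exists_Rd[OF P(1,2)] .
  have "A \<subseteq> Rd d" using A(3) P(2) span_superset by blast
  have "infdist x (span (B \<union> A)) \<le> infdist (x - orth_proj (span B) x) P" for x
    unfolding infdist_notempty[OF subspace_0[OF P(1), THEN ex_in_conv[THEN iffD1, OF exI]]]
  proof (rule cINF_greatest)
    fix y assume y: "y \<in> P"
    have "orth_proj (span B) x + y \<in> span (B \<union> A)"
      using orth_proj_span(1)[OF B(1), of x] y A(3) span_mono[of B "B \<union> A"] span_mono[of A "B \<union> A"]
      by (intro span_add) auto
    from infdist_le[OF this, of x]
    show "infdist x (span (B \<union> A)) \<le> dist (x - orth_proj (span B) x) y"
      by (simp add: dist_norm algebra_simps)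
  qed (use subspace_0[OF P(1)] in auto)
  then have "cost z X (span (B \<union> A)) \<le> (\<Sum>x\<in>X. dist_pow z (x - orth_proj (span B) x) P)"
    unfolding cost_def dist_pow_def using assms(3)
    by (intro sum_mono powr_mono2) (auto simp: infdist_nonneg)
  with sat[OF A(1) \<open>A \<subseteq> Rd d\<close>] A(2) P(3) show ?thesis by simp
qed

text \<open>Saturation bounds the optimum over \<open>X\<close> from below, the weak coreset carries
  this to \<open>S\<close>, and \<open>P\<close> is one of the competitors there. The loss
  \<open>4 * h * M\<close> is one \<open>h * M\<close> from saturation, two from the factor
  \<open>1 - h\<close> on a cost of at most \<open>2 * M\<close>, and one from
  \<open>SB\<close>.\<close>

lemma weak_coreset_residual_le:
  assumes B: "finite B" "B \<subseteq> Rd d" and X: "X \<subseteq> Rd d" "S \<subseteq> X" "\<And>x. x \<in> S \<Longrightarrow> 0 \<le> w x"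
    and "0 \<le> z" "0 \<le> h" "h \<le> 1" "0 \<le> M"
    and XB: "cost z X (span B) \<le> 2 * M"
    and sat: "\<And>P. finite P \<Longrightarrow> P \<subseteq> Rd d \<Longrightarrow> card P \<le> k \<Longrightarrow>
      cost z X (span B) - cost z X (span (B \<union> P)) \<le> h * M"
    and weak: "weak_coreset h k z (Rd d \<inter> (span B)\<^sup>\<bottom>) (orth_proj (Rd d \<inter> (span B)\<^sup>\<bottom>)) X S w"
    and SB: "\<bar>wcost z S w (span B) - cost z X (span B)\<bar> \<le> h * M"
    and P: "subspace P" "P \<subseteq> Rd d \<inter> (span B)\<^sup>\<bottom>" "dim P \<le> k"
  shows "wcost z S w (span B) - (\<Sum>x\<in>S. w x * dist_pow z (x - orth_proj (span B) x) P) \<le> 4 * h * M"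
proof -
  let ?E = "Rd d \<inter> (span B)\<^sup>\<bottom>"
  let ?oX = "opt_subspace k z ?E (orth_proj ?E) X (\<lambda>_. 1)"
  let ?oS = "opt_subspace k z ?E (orth_proj ?E) S w"
  have proj: "orth_proj ?E x = x - orth_proj (span B) x" if "x \<in> X" for x
    using that X B by (intro orth_proj_orthogonal_comp(2)) auto
  have "cost z X (span B) - h * M \<le> ?oX"
  proof (rule opt_subspace_ge)
    show "0 \<in> ?E" by (intro subspace_0 subspace_inter subspace_Rd subspace_orthogonal_comp)
    fix Q assume "subspace Q" "Q \<subseteq> ?E" "dim Q \<le> k"
    then have "cost z X (span B) - h * M \<le> (\<Sum>x\<in>X. dist_pow z (x - orth_proj (span B) x) Q)"
      using B assms(6) sat by (intro cost_saturated_le) auto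
    then show "cost z X (span B) - h * M \<le> (\<Sum>x\<in>X. 1 * dist_pow z (orth_proj ?E x) Q)"
      by (simp add: proj)
  qed
  then have "(1 - h) * (cost z X (span B) - h * M) \<le> (1 - h) * ?oX"
    using assms(8) by (intro mult_left_mono) auto
  also have "\<dots> \<le> ?oS" using weak by (simp add: weak_coreset_def approx_def)
  also have "\<dots> \<le> (\<Sum>x\<in>S. w x * dist_pow z (orth_proj ?E x) P)"
    using P X by (intro opt_subspace_le) auto
  also have "\<dots> = (\<Sum>x\<in>S. w x * dist_pow z (x - orth_proj (span B) x) P)"
    using X proj by (intro sum.cong) auto
  finally have "(1 - h) * (cost z X (span B) - h * M) \<le> \<dots>" .
  moreover have "h * (cost z X (span B) - h * M) \<le> h * (2 * M)"
    using XB assms(7,9) by (intro mult_left_mono) (auto simp: add_increasing2 diff_le_eq)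
  ultimately show ?thesis using SB by (simp add: algebra_simps)
qed

section \<open>Constants, the degenerate case of a full span, and assembly of the estimates\<close>

theorem corollary5p15:
  fixes z :: real
  assumes "z \<ge> 1"
  shows "\<exists>c\<^sub>1>0. \<exists>c\<^sub>2>0.
    \<forall>(d::nat) (X::fseq set) (\<epsilon>::real) (\<delta>::real) (k::nat).
      d \<ge> 1 \<longrightarrow> finite X \<longrightarrow> X \<subseteq> Rd d \<longrightarrow> \<epsilon> \<in> {0<..<1/2} \<longrightarrow> \<delta> \<in> {0<..<1/2} \<longrightarrow> k \<ge> 1 \<longrightarrow>
      (let \<epsilon>' = \<epsilon> powr (z + 3) / (6 * (84 * z) powr (2 * z)) in
       \<exists>\<Gamma>. subspace \<Gamma> \<and> \<Gamma> \<subset> Rd d \<and> real (dim \<Gamma>) \<le> c\<^sub>1 * (real k / \<epsilon>') \<and>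
         (\<forall>v\<in>Rd d \<inter> \<Gamma>\<^sup>\<bottom>. v \<noteq> 0 \<longrightarrow>
           (\<forall>S w. S \<subseteq> X \<longrightarrow> (\<forall>x\<in>S. w x \<ge> 0) \<longrightarrow>
             coreset \<epsilon> k z (span (insert v \<Gamma>)) X S w \<longrightarrow>
             weak_coreset \<epsilon>' k z (Rd d \<inter> \<Gamma>\<^sup>\<bottom>) (orth_proj (Rd d \<inter> \<Gamma>\<^sup>\<bottom>)) X S w \<longrightarrow>
             \<bar>wcost z S w \<Gamma> - cost z X \<Gamma>\<bar> \<le> \<epsilon>' * opt_cost k z (Rd d) X \<longrightarrow>
             coreset (c\<^sub>2 * \<epsilon>) k z (Rd d) X S w)))"
proof -
  \<comment> \<open>The constant of \<open>wcost_lifted_centers\<close>;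
    \<open>approx_trans_perturb\<close> turns it into \<open>12 * K\<^sup>2\<close>.\<close>
  define K where "K = z * 2 powr z * (28 * 4 powr z)"
  have "1 * 1 * (1 * 1) \<le> K"
    unfolding K_def using assms by (intro mult_mono ge_one_powr_ge_zero) auto
  then have K: "1 \<le> K" by simp
  have KK: "1 \<le> 12 * K\<^sup>2" using one_le_power[OF K, of 2] by linarith
  show ?thesis
  proof (rule exI[of _ 5], rule conjI, simp, rule exI[of _ "12 * K\<^sup>2"], intro conjI allI impI)
    fix d :: nat and X :: "fseq set" and e dl :: real and k :: nat
    assume d: "1 \<le> d" and X: "finite X" "X \<subseteq> Rd d" and "e \<in> {0<..<1/2}" and k: "1 \<le> k"
    then have e: "0 < e" "e \<le> 1" by auto
    define h where "h = e powr (z + 3) / (6 * (84 * z) powr (2 * z))"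
    define M where "M = opt_cost k z (Rd d) X"
    have "1 * 1 \<le> 6 * (84 * z) powr (2 * z)"
      using assms by (intro mult_mono ge_one_powr_ge_zero) auto
    then have h: "0 < h" "h \<le> e powr (z + 3)"
      using e assms by (auto simp: h_def divide_le_eq_1 field_simps mult_left_le_one_le)
    have "e powr (z + 3) \<le> 1" using e assms by (intro powr_le1) auto
    then have h1: "h \<le> 1" using h by simp
    have M0: "0 \<le> M" unfolding M_def by (rule opt_cost_nonneg[OF subspace_0[OF subspace_Rd]])
    have z0: "0 \<le> z" using assms by simp
    obtain B where B: "finite B" "B \<subseteq> Rd d" "real (card B) \<le> real k * (2 / h + 3)"
      "cost z X (span B) \<le> 2 * M"
      and sat: "\<And>P. finite P \<Longrightarrow> P \<subseteq> Rd d \<Longrightarrow> card P \<le> k \<Longrightarrow>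
        cost z X (span B) - cost z X (span (B \<union> P)) \<le> h * M"
      using saturated_span_exists[OF X subspace_Rd k z0 h(1)] unfolding M_def by blast
    \<comment> \<open>From \<open>h \<le> 1\<close>: the summand 3 is at most \<open>3 / h\<close>,
      which gives the dimension constant 5.\<close>
    have "real (card B) \<le> real k * (5 / h)"
    proof -
      have "2 / h + 3 \<le> 5 / h" using h h1 by (simp add: field_simps)
      then show ?thesis using B(3) mult_left_mono[of "2 / h + 3" "5 / h" "real k"] by simp
    qed
    then have cardB: "real (card B) \<le> 5 * (real k / h)" by (simp add: mult.commute)
    have BR: "span B \<subseteq> Rd d" using B by (intro span_minimal subspace_Rd)
    have dimB: "dim (span B) \<le> card B" using B by (intro dim_le_card) auto
    let ?goal = "\<lambda>\<Gamma>. subspace \<Gamma> \<and> \<Gamma> \<subset> Rd d \<and> real (dim \<Gamma>) \<le> 5 * (real k / h) \<and>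
         (\<forall>v\<in>Rd d \<inter> \<Gamma>\<^sup>\<bottom>. v \<noteq> 0 \<longrightarrow>
           (\<forall>S w. S \<subseteq> X \<longrightarrow> (\<forall>x\<in>S. w x \<ge> 0) \<longrightarrow>
             coreset e k z (span (insert v \<Gamma>)) X S w \<longrightarrow>
             weak_coreset h k z (Rd d \<inter> \<Gamma>\<^sup>\<bottom>) (orth_proj (Rd d \<inter> \<Gamma>\<^sup>\<bottom>)) X S w \<longrightarrow>
             \<bar>wcost z S w \<Gamma> - cost z X \<Gamma>\<bar> \<le> h * opt_cost k z (Rd d) X \<longrightarrow>
             coreset (12 * K\<^sup>2 * e) k z (Rd d) X S w))"
    have "\<exists>\<Gamma>. ?goal \<Gamma>"
    proof (cases "span B = Rd d")
      case True
      \<comment> \<open>\<open>\<Gamma>\<close> has to be proper: for a hyperplane, \<open>\<Gamma>'\<close> is the whole space.\<close>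
      obtain d' where d': "d = Suc d'" using d by (cases d) auto
      have "?goal (Rd d')"
      proof (intro conjI ballI allI impI)
        show "subspace (Rd d')" by (rule subspace_Rd)
        have "Rd d' \<subseteq> Rd d" by (auto simp: Rd_def d')
        moreover have "Rd d' \<noteq> Rd d" using dim_Rd[of d'] dim_Rd[of d] d' by auto
        ultimately show "Rd d' \<subset> Rd d" by blast
        \<comment> \<open>The full span has dimension \<open>d\<close>, so
          \<open>d' < d \<le> card B\<close>.\<close>
        have "dim (Rd d') \<le> card B" using True dimB d' by (simp add: dim_Rd)
        then show "real (dim (Rd d')) \<le> 5 * (real k / h)" using cardB by linarith
        fix v S w
        assume "v \<in> Rd d \<inter> (Rd d')\<^sup>\<bottom>" "v \<noteq> 0" "coreset e k z (span (insert v (Rd d'))) X S w"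
        then have "coreset e k z (Rd d) X S w" by (simp add: span_insert_hyperplane d')
        then show "coreset (12 * K\<^sup>2 * e) k z (Rd d) X S w"
          using KK e mult_right_mono[of 1 "12 * K\<^sup>2" e] by (auto elim: coreset_mono)
      qed
      then show ?thesis by blast
    next
      case False
      have "?goal (span B)"
      proof (intro conjI ballI allI impI)
        show "subspace (span B)" by (rule subspace_span)
        show "span B \<subset> Rd d" using BR False by blast
        show "real (dim (span B)) \<le> 5 * (real k / h)" using cardB dimB by linarith
        fix v S w
        assume v: "v \<in> Rd d \<inter> (span B)\<^sup>\<bottom>" "v \<noteq> 0" and S: "S \<subseteq> X" "\<forall>x\<in>S. w x \<ge> 0"
          and core: "coreset e k z (span (insert v (span B))) X S w"
          and weak: "weak_coreset h k z (Rd d \<inter> (span B)\<^sup>\<bottom>) (orth_proj (Rd d \<inter> (span B)\<^sup>\<bottom>)) X S w"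
          and "\<bar>wcost z S w (span B) - cost z X (span B)\<bar> \<le> h * opt_cost k z (Rd d) X"
        then have SB: "\<bar>wcost z S w (span B) - cost z X (span B)\<bar> \<le> h * M" by (simp add: M_def)
        let ?p = "orth_proj (span B)"
        let ?q = "\<lambda>x. x - ?p x"
        define u where "u = v /\<^sub>R norm v"
        have u: "norm u = 1" "\<And>g. g \<in> span B \<Longrightarrow> inner u g = 0"
          using v by (auto simp: u_def orthogonal_comp_def orthogonal_def inner_commute)
        have sE: "subspace (Rd d \<inter> (span B)\<^sup>\<bottom>)"
          by (intro subspace_inter subspace_Rd subspace_orthogonal_comp)
        have uE: "u \<in> Rd d \<inter> (span B)\<^sup>\<bottom>"
          unfolding u_def using v(1) by (rule subspace_scale[OF sE])
        have hM: "h * M \<le> e powr (z + 3) * M" "0 \<le> h * M" "h * M \<le> M"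
          using h h1 M0 by (auto intro: mult_right_mono mult_left_le_one_le)
        show "coreset (12 * K\<^sup>2 * e) k z (Rd d) X S w"
          unfolding coreset_def
        proof
          fix Cs assume Cs: "Cs \<in> center_tuples k (Rd d)"
          define C where "C = set Cs"
          have C: "finite C" "C \<noteq> {}" "C \<subseteq> Rd d" "card C \<le> k"
            using Cs k card_length[of Cs] by (auto simp: C_def center_tuples_def)
          define f where "f = (\<lambda>c. ?p c + norm (?q c) *\<^sub>R u)"
          \<comment> \<open>Both directions to be tested, the span of the residuals of the centers
            and the line along \<open>u\<close>, are competitors of dimension at most
            \<open>k\<close>; for the line this uses \<open>1 \<le> k\<close>.\<close>
          have H: "subspace (span A) \<and> span A \<subseteq> Rd d \<inter> (span B)\<^sup>\<bottom> \<and> dim (span A) \<le> k"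
            if A: "A \<in> {?q ` C, {u}}" for A
          proof -
            have fin: "finite A" "card A \<le> k"
              using A C k card_image_le[of C ?q] by auto
            have "?q ` C \<subseteq> Rd d \<inter> (span B)\<^sup>\<bottom>"
              using C(3) B orth_proj_orthogonal_comp(1)[OF B(1,2)] by blast
            then have "A \<subseteq> Rd d \<inter> (span B)\<^sup>\<bottom>" using A uE by auto
            then have "span A \<subseteq> Rd d \<inter> (span B)\<^sup>\<bottom>" by (rule span_minimal[OF _ sE])
            moreover have "dim (span A) \<le> k" using dim_le_card[of "span A" A] fin by auto
            ultimately show ?thesis by simp
          qed
          have XC: "\<bar>wcost z X (\<lambda>_. 1) C - wcost z X (\<lambda>_. 1) (f ` C)\<bar>
              \<le> z * 2 powr z * (28 * 4 powr z) * e * (wcost z X (\<lambda>_. 1) C + M)"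
            unfolding f_def
          proof (rule wcost_lifted_centers(1)[where Y = X and w = "\<lambda>_. 1" and M = M, OF B(1) C(1,2) u assms e])
            show "(\<Sum>x\<in>X. 1 * norm (?q x) powr z) \<le> 3 * M"
              using B(4) M0 by (simp add: cost_def dist_pow_span[OF B(1)])
            fix A assume "A \<in> {?q ` C, {u}}"
            then have "cost z X (span B) - h * M \<le> (\<Sum>x\<in>X. dist_pow z (?q x) (span A))"
              using H[of A] B sat z0 by (intro cost_saturated_le) auto
            then show "(\<Sum>x\<in>X. 1 * norm (?q x) powr z) - (\<Sum>x\<in>X. 1 * dist_pow z (?q x) (span A))
                \<le> 4 * e powr (z + 3) * M"
              using hM by (simp add: cost_def dist_pow_span[OF B(1)])
          qed auto
          have SC: "\<bar>wcost z S w C - wcost z S w (f ` C)\<bar>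
              \<le> z * 2 powr z * (28 * 4 powr z) * e * (wcost z S w (f ` C) + M)"
            unfolding f_def
          proof (rule wcost_lifted_centers(2)[where Y = S and w = w and M = M, OF B(1) C(1,2) u assms e])
            \<comment> \<open>At most \<open>2 * M\<close> for the cost over \<open>X\<close>, plus
              \<open>h * M \<le> M\<close> from the third condition.\<close>
            show "(\<Sum>x\<in>S. w x * norm (?q x) powr z) \<le> 3 * M"
              using SB B(4) hM by (simp add: wcost_def dist_pow_span[OF B(1)])
            fix A assume "A \<in> {?q ` C, {u}}"
            then have "wcost z S w (span B) - (\<Sum>x\<in>S. w x * dist_pow z (?q x) (span A)) \<le> 4 * h * M"
              using H[of A] S h h1 M0
              by (intro weak_coreset_residual_le[OF B(1,2) X(2) S(1) _ z0 _ _ _ B(4) sat weak SB]) auto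
            then show "(\<Sum>x\<in>S. w x * norm (?q x) powr z) - (\<Sum>x\<in>S. w x * dist_pow z (?q x) (span A))
                \<le> 4 * e powr (z + 3) * M"
              using hM by (simp add: wcost_def dist_pow_span[OF B(1)])
          next
            show "0 \<le> w x" if "x \<in> S" for x using that S(2) by blast
          qed
          have "f c \<in> span (insert v (span B))" for c
          proof -
            have "?p c \<in> span (insert v (span B))" "u \<in> span (insert v (span B))"
              unfolding u_def using orth_proj_span(1)[OF B(1), of c]
              by (auto intro: span_base span_scale)
            then show ?thesis unfolding f_def by (intro span_add span_scale)
          qed
          \<comment> \<open>Mapping the tuple keeps its length even if centers coincide after
            lifting.\<close>
          then have "map f Cs \<in> center_tuples k (span (insert v (span B)))"
            using Cs by (auto simp: center_tuples_def)
          with core have "approx e (wcost z X (\<lambda>_. 1) (f ` C)) (wcost z S w (f ` C))"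
            by (auto simp: coreset_def C_def cost_eq_wcost dest!: bspec)
          moreover have "M \<le> wcost z X (\<lambda>_. 1) C"
            using opt_cost_le[OF Cs, of z X] by (simp add: M_def C_def cost_eq_wcost)
          ultimately have "approx (12 * K\<^sup>2 * e) (wcost z X (\<lambda>_. 1) C) (wcost z S w C)"
            using XC SC e K M0 unfolding K_def by (intro approx_trans_perturb) auto
          then show "approx (12 * K\<^sup>2 * e) (cost z X (set Cs)) (wcost z S w (set Cs))"
            by (simp add: C_def cost_eq_wcost)
        qed
      qed
      then show ?thesis by blast
    qed
    then show "let \<epsilon>' = e powr (z + 3) / (6 * (84 * z) powr (2 * z)) in \<exists>\<Gamma>. subspace \<Gamma> \<and> \<Gamma> \<subset> Rd d \<and>
        real (dim \<Gamma>) \<le> 5 * (real k / \<epsilon>') \<and>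
         (\<forall>v\<in>Rd d \<inter> \<Gamma>\<^sup>\<bottom>. v \<noteq> 0 \<longrightarrow>
           (\<forall>S w. S \<subseteq> X \<longrightarrow> (\<forall>x\<in>S. w x \<ge> 0) \<longrightarrow>
             coreset e k z (span (insert v \<Gamma>)) X S w \<longrightarrow>
             weak_coreset \<epsilon>' k z (Rd d \<inter> \<Gamma>\<^sup>\<bottom>) (orth_proj (Rd d \<inter> \<Gamma>\<^sup>\<bottom>)) X S w \<longrightarrow>
             \<bar>wcost z S w \<Gamma> - cost z X \<Gamma>\<bar> \<le> \<epsilon>' * opt_cost k z (Rd d) X \<longrightarrow>
             coreset (12 * K\<^sup>2 * e) k z (Rd d) X S w))"
      by (simp only: Let_def h_def)
  qed (use K in auto)
qed

end
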